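(* Let $(A,H,\phi;+,\{\cdot_\lambda\}_{\lambda\in H})$ be a dynamical brace. Then the maps $R(\lambda):A\times A\to A\times A$ ($\lambda\in H$) defined by $$R(\lambda)(a,b):=\bigl(\gamma_\lambda(\gamma_\lambda(a)(b))^{-1}(a),\ \gamma_\lambda(a)(b)\bigr)$$ form a right nondegenerate unitary dynamical Yang-Baxter map associated with $A,H,\phi$.
   Context: Dynamical brace: Let $H$ be a non-empty set, $(A,+)$ an abelian group with a family of multiplications (binary operations, not assumed associative) $\{\cdot_\lambda:A\times A\to A\}_{\lambda\in H}$, and $\phi:H\times A\to H$ a map. $(A,H,\phi;+,\{\cdot_\lambda\}_{\lambda\in H})$ is called a dynamical brace (d-brace) if for all $(\lambda,a,b,c)\in H\times A\times A\times A$: 1. $(a+b)\cdot_\lambda c=a\cdot_\lambda c+b\cdot_\lambda c$; 2. $a\cdot_\lambda(b\cdot_\lambda c+b+c)=(a\cdot_{\phi(\lambda,c)}b)\cdot_\lambda c+a\cdot_{\phi(\lambda,c)}b+a\cdot_\lambda c$; 3. the map $\gamma_\lambda(b):A\to A$, $a\mapsto a\cdot_\lambda b+a$, is bijective. Dynamical Yang-Baxter map: Let $X,H$ be non-empty sets and $\phi:H\times X\to H$ a map. A family of maps $R(\lambda):X\times X\to X\times X$ ($\lambda\in H$) is a dynamical Yang-Baxter map (DYB map) associated with $X,H,\phi$ if for all $\lambda\in H$, as maps on $X\times X\times X$, $$R_{23}(\lambda)R_{13}(\phi(\lambda,X^{(2)}))R_{12}(\lambda)=R_{12}(\phi(\lambda,X^{(3)}))R_{13}(\lambda)R_{23}(\phi(\lambda,X^{(1)})).$$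 Here products are compositions, $R_{ij}(\lambda)$ applies $R(\lambda)$ to the $i$-th and $j$-th components and fixes the remaining one, and $R_{ij}(\phi(\lambda,X^{(k)}))$ (with $\{i,j,k\}=\{1,2,3\}$) applies $R(\phi(\lambda,x_k))$ to the $i$-th and $j$-th components of $(x_1,x_2,x_3)$ and fixes $x_k$; e.g. $R_{12}(\lambda)(a,b,c)=(R(\lambda)(a,b),c)$ and $R_{12}(\phi(\lambda,X^{(3)}))(a,b,c)=(R(\phi(\lambda,c))(a,b),c)$. Write $R(\lambda)(a,b)=(\mathfrak{R}^\lambda_b(a),\mathfrak{L}^\lambda_a(b))$. $R(\lambda)$ is right nondegenerate if $\mathfrak{L}^\lambda_a:X\to X$ is bijective for all $(\lambda,a)\in H\times X$. It is unitary if $PR(\lambda)PR(\lambda)=\mathrm{id}_{X\times X}$ for all $\lambda\in H$, where $P(a,b)=(b,a)$. *)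

theory Defs
  imports Main
begin

text \<open>
  The non-empty sets \<open>A\<close> (resp. \<open>X\<close>) and \<open>H\<close> are rendered as types; the additive group of \<open>A\<close>
  is its \<^class>\<open>ab_group_add\<close> structure. The multiplications are written \<open>mult \<lambda> a b\<close> for
  \<open>a \<cdot>\<^sub>\<lambda> b\<close>.
\<close>

definition gamma :: "('h \<Rightarrow> 'a \<Rightarrow> 'a \<Rightarrow> 'a) \<Rightarrow> 'h \<Rightarrow> 'a \<Rightarrow> 'a \<Rightarrow> 'a::ab_group_add"
  where "gamma mult l b = (\<lambda>a. mult l a b + a)"

locale dynamical_brace =
  fixes phi :: "'h \<Rightarrow> 'a::ab_group_add \<Rightarrow> 'h"
    and mult :: "'h \<Rightarrow> 'a \<Rightarrow> 'a \<Rightarrow> 'a"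
  assumes right_distrib: "mult l (a + b) c = mult l a c + mult l b c"
    and dynamical_assoc:
      "mult l a (mult l b c + b + c) =
         mult l (mult (phi l c) a b) c + mult (phi l c) a b + mult l a c"
    and bij_gamma: "bij (gamma mult l b)"

text \<open>
  \<open>legij F\<close> applies a map to the components \<open>i\<close> and \<open>j\<close>, where the map applied is \<open>F x\<^sub>k\<close> with
  \<open>x\<^sub>k\<close> the remaining component, which is kept. Thus \<open>R\<^sub>i\<^sub>j(\<lambda>)\<close> is \<open>legij (\<lambda>_. R \<lambda>)\<close> and
  \<open>R\<^sub>i\<^sub>j(\<phi>(\<lambda>, X\<^sup>(\<^sup>k\<^sup>)))\<close> is \<open>legij (\<lambda>x. R (\<phi> \<lambda> x))\<close>.
\<close>

definition leg12 :: "('x \<Rightarrow> 'x \<times> 'x \<Rightarrow> 'x \<times> 'x) \<Rightarrow> 'x \<times> 'x \<times> 'x \<Rightarrow> 'x \<times> 'x \<times> 'x"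
  where "leg12 F = (\<lambda>(a, b, c). case F c (a, b) of (a', b') \<Rightarrow> (a', b', c))"

definition leg13 :: "('x \<Rightarrow> 'x \<times> 'x \<Rightarrow> 'x \<times> 'x) \<Rightarrow> 'x \<times> 'x \<times> 'x \<Rightarrow> 'x \<times> 'x \<times> 'x"
  where "leg13 F = (\<lambda>(a, b, c). case F b (a, c) of (a', c') \<Rightarrow> (a', b, c'))"

definition leg23 :: "('x \<Rightarrow> 'x \<times> 'x \<Rightarrow> 'x \<times> 'x) \<Rightarrow> 'x \<times> 'x \<times> 'x \<Rightarrow> 'x \<times> 'x \<times> 'x"
  where "leg23 F = (\<lambda>(a, b, c). case F a (b, c) of (b', c') \<Rightarrow> (a, b', c'))"

definition dynamical_yang_baxter_map ::
    "('h \<Rightarrow> 'x \<Rightarrow> 'h) \<Rightarrow> ('h \<Rightarrow> 'x \<times> 'x \<Rightarrow> 'x \<times> 'x) \<Rightarrow> bool"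
  where "dynamical_yang_baxter_map phi R \<longleftrightarrow>
    (\<forall>l. leg23 (\<lambda>_. R l) \<circ> leg13 (\<lambda>x. R (phi l x)) \<circ> leg12 (\<lambda>_. R l) =
         leg12 (\<lambda>x. R (phi l x)) \<circ> leg13 (\<lambda>_. R l) \<circ> leg23 (\<lambda>x. R (phi l x)))"

definition right_nondegenerate :: "('h \<Rightarrow> 'x \<times> 'x \<Rightarrow> 'x \<times> 'x) \<Rightarrow> bool"
  where "right_nondegenerate R \<longleftrightarrow> (\<forall>l a. bij (\<lambda>b. snd (R l (a, b))))"

definition unitary :: "('h \<Rightarrow> 'x \<times> 'x \<Rightarrow> 'x \<times> 'x) \<Rightarrow> bool"
  where "unitary R \<longleftrightarrow> (\<forall>l. prod.swap \<circ> R l \<circ> prod.swap \<circ> R l = id)"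

definition brace_map ::
    "('h \<Rightarrow> 'a \<Rightarrow> 'a \<Rightarrow> 'a) \<Rightarrow> 'h \<Rightarrow> 'a \<times> 'a \<Rightarrow> 'a \<times> 'a::ab_group_add"
  where "brace_map mult l = (\<lambda>(a, b).
    (inv (gamma mult l (gamma mult l a b)) a, gamma mult l a b))"

end

theory Submission
  imports Defs
begin

text \<open>
  The dynamical associativity axiom says that \<open>\<gamma>\<^sub>\<lambda>(c) \<circ> \<gamma>\<^bsub>\<phi>(\<lambda>,c)\<^esub>(b)\<close> depends on \<open>b\<close> and \<open>c\<close>
  only through \<open>\<gamma>\<^sub>\<lambda>(c)(b) + c\<close>. If \<open>R(\<lambda>)(a, b) = (a', b')\<close>, that is \<open>b' = \<gamma>\<^sub>\<lambda>(a)(b)\<close> and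
  \<open>\<gamma>\<^sub>\<lambda>(b')(a') = a\<close>, then \<open>\<gamma>\<^sub>\<lambda>(b')(a') + b' = \<gamma>\<^sub>\<lambda>(a)(b) + a\<close> by commutativity of addition, so
  \<open>\<gamma>\<^sub>\<lambda>(b') \<circ> \<gamma>\<^bsub>\<phi>(\<lambda>,b')\<^esub>(a') = \<gamma>\<^sub>\<lambda>(a) \<circ> \<gamma>\<^bsub>\<phi>(\<lambda>,a)\<^esub>(b)\<close>. This exchange relation gives the Yang-Baxter
  equation component by component, after cancelling injective maps \<open>\<gamma>\<close>.
\<close>

context dynamical_brace
begin

abbreviation \<gamma> :: "'h \<Rightarrow> 'a \<Rightarrow> 'a \<Rightarrow> 'a"
  where "\<gamma> \<equiv> gamma mult"

lemma gamma_add: "\<gamma> l c (a + b) = \<gamma> l c a + \<gamma> l c b"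
  by (simp add: gamma_def right_distrib algebra_simps)

lemma gamma_inj: "\<gamma> l b x = \<gamma> l b y \<longleftrightarrow> x = y"
  using bij_gamma by (simp add: bij_is_inj inj_eq)

lemma inv_gamma_eq_iff: "inv (\<gamma> l b) x = y \<longleftrightarrow> \<gamma> l b y = x"
  using bij_inv_eq_iff[OF bij_gamma] by metis

text \<open>Add \<open>x\<close> to dynamical associativity and collect by additivity of
  \<open>\<gamma> l c\<close>.\<close>

lemma gamma_gamma: "\<gamma> l c (\<gamma> (phi l c) b x) = \<gamma> l (\<gamma> l c b + c) x"
proof -
  have "\<gamma> l (\<gamma> l c b + c) x = \<gamma> l c (mult (phi l c) x b) + \<gamma> l c x"
    by (simp add: gamma_def dynamical_assoc[unfolded add.assoc] add.assoc)
  also have "\<dots> = \<gamma> l c (\<gamma> (phi l c) b x)"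
    by (simp add: gamma_add[symmetric] gamma_def[of mult "phi l c"])
  finally show ?thesis ..
qed

lemma brace_map_eq_iff:
  "brace_map mult l (a, b) = (a', b') \<longleftrightarrow> \<gamma> l a b = b' \<and> \<gamma> l b' a' = a"
  by (auto simp: brace_map_def inv_gamma_eq_iff)

lemma brace_map_exchange:
  assumes "brace_map mult l (a, b) = (a', b')"
  shows "\<gamma> l b' (\<gamma> (phi l b') a' x) = \<gamma> l a (\<gamma> (phi l a) b x)"
  using assms by (simp add: gamma_gamma brace_map_eq_iff add.commute)

lemma dynamical_yang_baxter_map_brace_map:
  "dynamical_yang_baxter_map phi (brace_map mult)"
  unfolding dynamical_yang_baxter_map_def
proof (intro allI ext)
  let ?R = "brace_map mult"
  fix l and x :: "'a \<times> 'a \<times> 'a"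
  obtain a b c where x: "x = (a, b, c)"
    by (cases x)
  obtain a1 b1 where L1: "?R l (a, b) = (a1, b1)" by fastforce
  obtain a2 c1 where L2: "?R (phi l b1) (a1, c) = (a2, c1)" by fastforce
  obtain b2 c2 where L3: "?R l (b1, c1) = (b2, c2)" by fastforce
  obtain b3 c3 where R1: "?R (phi l a) (b, c) = (b3, c3)" by fastforce
  obtain a3 c4 where R2: "?R l (a, c3) = (a3, c4)" by fastforce
  obtain a4 b4 where R3: "?R (phi l c4) (a3, b3) = (a4, b4)" by fastforce
  note eqs = L1[unfolded brace_map_eq_iff] L2[unfolded brace_map_eq_iff]
    L3[unfolded brace_map_eq_iff] R1[unfolded brace_map_eq_iff]
    R2[unfolded brace_map_eq_iff] R3[unfolded brace_map_eq_iff]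
  have c: "c2 = c4"
    using brace_map_exchange[OF L1, of c] eqs by simp
  \<comment> \<open>Both sides equal \<open>b1\<close>, by \<open>R1\<close> and \<open>L1\<close>
    on the left and by \<open>L3\<close> on the right.\<close>
  have "\<gamma> l c4 b4 = \<gamma> l c4 b2"
    using brace_map_exchange[OF R2, of b3] eqs c by simp
  then have b: "b2 = b4"
    by (simp add: gamma_inj)
  \<comment> \<open>Both sides equal \<open>a\<close>.\<close>
  have "\<gamma> l c4 (\<gamma> (phi l c4) b4 a2) = \<gamma> l c4 (\<gamma> (phi l c4) b4 a4)"
    using brace_map_exchange[OF L3, of a2] eqs b c by simp
  then have a: "a2 = a4"
    by (simp add: gamma_inj)
  show "(leg23 (\<lambda>_. ?R l) \<circ> leg13 (\<lambda>x. ?R (phi l x)) \<circ> leg12 (\<lambda>_. ?R l)) x =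
      (leg12 (\<lambda>x. ?R (phi l x)) \<circ> leg13 (\<lambda>_. ?R l) \<circ> leg23 (\<lambda>x. ?R (phi l x))) x"
    by (simp add: x leg12_def leg13_def leg23_def L1 L2 L3 R1 R2 R3 a b c)
qed

lemma right_nondegenerate_brace_map: "right_nondegenerate (brace_map mult)"
  using bij_gamma by (simp add: right_nondegenerate_def brace_map_def)

text \<open>The two equations of \<open>brace_map_eq_iff\<close> trade places when
  \<open>(a, b)\<close> and \<open>(b', a')\<close> are exchanged.\<close>

lemma unitary_brace_map: "unitary (brace_map mult)"
  by (auto simp: unitary_def fun_eq_iff brace_map_def inv_gamma_eq_iff
      bij_is_surj[OF bij_gamma] surj_f_inv_f)

end

theorem corollary3p2p1:
  fixes phi :: "'h \<Rightarrow> 'a::ab_group_add \<Rightarrow> 'h"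
    and mult :: "'h \<Rightarrow> 'a \<Rightarrow> 'a \<Rightarrow> 'a"
  assumes "dynamical_brace phi mult"
  shows "dynamical_yang_baxter_map phi (brace_map mult)
    \<and> right_nondegenerate (brace_map mult)
    \<and> unitary (brace_map mult)"
  using dynamical_brace.dynamical_yang_baxter_map_brace_map[OF assms]
    dynamical_brace.right_nondegenerate_brace_map[OF assms]
    dynamical_brace.unitary_brace_map[OF assms]
  by blast

end
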